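(* Let $A=M_n(\mathbb{C})$, let $\psi$ be a state on $A$, let $a\in A_{sa}$, and let $\Delta\subseteq\mathbb{R}$ be open. If $\underline{[a\in\Delta]}$ is defined using $\delta^{i}(\chi_{\Delta}(a))$, and $C$ is a maximal context in $\mathcal{C}$, then the following conditions are equivalent in the covariant model: 1. $C\Vdash\underline{\mu}(\neg\underline{[a\in\Delta]})=\underline{1}$; 2. For each projection $p\in C$, if $p\leq\chi_{\Delta}(a)$, then $\psi(p)=0$; 3. For each projection $p\in C$, if $p\geq\chi_{\mathbb{R}-\Delta}(a)$, then $\psi(p)=1$.
   Context: Covariant model: $\mathcal{C}$ is the poset (under inclusion) of abelian von Neumann subalgebras of $A$ (containing the unit of $A$); the topos is $[\mathcal{C},\mathbf{Set}]$. $\Sigma_C$ is the Gelfand spectrum of $C$. $\Sigma_{\uparrow}=\coprod_C\Sigma_C$ with $U$ open iff (1) if $\lambda\in U_D$, $D\subseteq C$, $\lambda'\in\Sigma_C$ and $\lambda'|_D=\lambda$, then $\lambda'\in U_C$, and (2) $U_C:=U\cap\Sigma_C$ is open in $\Sigma_C$ for all $C$. $\mathcal{O}\Sigma_{\uparrow}$ is a complete Heyting algebra under inclusion, and $\neg$ is its negation ($\neg U$ is the largest open disjoint from $U$). For a projection $p\in A$, $\delta^i(p)_C=\bigvee\{q\in\mathrm{Proj}(C)\mid q\leq p\}$. The elementary proposition $\underline{[a\in\Delta]}$ is (externally) the open $[a\in\Delta]=\{(C,\lambda)\in\Sigma_{\uparrow}\mid\lambda(\delta^i(\chi_\Delta(a))_C)=1\}$;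 $\chi_\Delta(a)$ denotes the spectral projection of $a$ for $\Delta$, and $\chi_{\mathbb{R}-\Delta}(a)=1-\chi_\Delta(a)$. $\underline{\mu}$ is the internal probability valuation (on the internal locale described by $\Sigma_{\uparrow}$) associated to $\psi$: externally $\mu(U)(C)=\mu^{C}(U_C)$ for $U\in\mathcal{O}\Sigma_{\uparrow}$, with $\mu^C:\mathcal{O}\Sigma_C\to[0,1]$ the probability valuation corresponding to $\psi|_C$ by Riesz–Markov (so if $U_C$ is the clopen set corresponding to the projection $p_C\in C$, then $\mu(U)(C)=\psi(p_C)$). By (co)presheaf semantics, $C\Vdash\underline{\mu}(\underline{U})=\underline{1}$ means $\mu(U)(E)=1$ for all $E\in\mathcal{C}$ with $E\supseteq C$. *)

theory Defs
  imports "HOL-Probability.Probability"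
begin

section \<open>The matrix algebra\<close>

text \<open>The algebra \<open>M\<^sub>n(\<complex>)\<close> is the type \<open>complex^'n^'n\<close> with product \<open>**\<close> and unit \<open>mat 1\<close>; the
  scalar multiple \<open>z x\<close> is written \<open>mat z ** x\<close>.\<close>

type_synonym 'n cmat = "complex^'n^'n"

definition adj :: "'n::finite cmat \<Rightarrow> 'n cmat" where
  "adj x = (\<chi> i j. cnj (x $ j $ i))"

definition self_adjoint :: "'n::finite cmat \<Rightarrow> bool" where
  "self_adjoint x \<longleftrightarrow> adj x = x"

definition positive_elt :: "'n::finite cmat \<Rightarrow> bool" where
  "positive_elt x \<longleftrightarrow> (\<exists>b. x = adj b ** b)"

definition le_elt :: "'n::finite cmat \<Rightarrow> 'n cmat \<Rightarrow> bool" (infix "\<preceq>" 50) where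
  "x \<preceq> y \<longleftrightarrow> positive_elt (y - x)"

definition is_projection :: "'n::finite cmat \<Rightarrow> bool" where
  "is_projection p \<longleftrightarrow> self_adjoint p \<and> p ** p = p"

definition is_state :: "('n::finite cmat \<Rightarrow> complex) \<Rightarrow> bool" where
  "is_state \<psi> \<longleftrightarrow>
     (\<forall>x y. \<psi> (x + y) = \<psi> x + \<psi> y) \<and> (\<forall>z x. \<psi> (mat z ** x) = z * \<psi> x) \<and>
     (\<forall>x. positive_elt x \<longrightarrow> \<psi> x \<in> \<real>\<^sub>\<ge>\<^sub>0) \<and> \<psi> (mat 1) = 1"

definition eigenprojection :: "'n::finite cmat \<Rightarrow> real \<Rightarrow> 'n cmat" where
  "eigenprojection a r =
     (THE p. is_projection p \<and> range ((*v) p) = {v. a *v v = complex_of_real r *s v})"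

text \<open>The spectral projection \<open>\<chi>\<^sub>\<Delta>(a)\<close>. The index set, the part of the point spectrum lying
  in \<open>\<Delta>\<close>, is finite because the matrix \<open>a\<close> has finitely many eigenvalues.\<close>

definition spectral_projection :: "'n::finite cmat \<Rightarrow> real set \<Rightarrow> 'n cmat" where
  "spectral_projection a \<Delta> =
     (\<Sum>r \<in> {r \<in> \<Delta>. \<exists>v. v \<noteq> 0 \<and> a *v v = complex_of_real r *s v}. eigenprojection a r)"


section \<open>Contexts and inner daseinisation\<close>

definition commutant :: "'n::finite cmat set \<Rightarrow> 'n cmat set" where
  "commutant S = {x. \<forall>y\<in>S. x ** y = y ** x}"

definition von_neumann_subalgebra :: "'n::finite cmat set \<Rightarrow> bool" where
  "von_neumann_subalgebra C \<longleftrightarrow>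
     mat 1 \<in> C \<and> (\<forall>x\<in>C. \<forall>y\<in>C. x + y \<in> C \<and> x ** y \<in> C) \<and>
     (\<forall>z. \<forall>x\<in>C. mat z ** x \<in> C) \<and> (\<forall>x\<in>C. adj x \<in> C) \<and>
     commutant (commutant C) = C"

definition contexts :: "'n::finite cmat set set" where
  "contexts = {C. von_neumann_subalgebra C \<and> (\<forall>x\<in>C. \<forall>y\<in>C. x ** y = y ** x)}"

definition maximal_context :: "'n::finite cmat set \<Rightarrow> bool" where
  "maximal_context C \<longleftrightarrow> C \<in> contexts \<and> (\<forall>D\<in>contexts. C \<subseteq> D \<longrightarrow> D = C)"

definition Proj :: "'n::finite cmat set \<Rightarrow> 'n cmat set" where
  "Proj C = {p \<in> C. is_projection p}"

definition Proj_Sup :: "'n::finite cmat set \<Rightarrow> 'n cmat set \<Rightarrow> 'n cmat" where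
  "Proj_Sup C Q = (THE s. s \<in> Proj C \<and> (\<forall>q\<in>Q. q \<preceq> s) \<and>
     (\<forall>t\<in>Proj C. (\<forall>q\<in>Q. q \<preceq> t) \<longrightarrow> s \<preceq> t))"

definition inner_das :: "'n::finite cmat \<Rightarrow> 'n cmat set \<Rightarrow> 'n cmat" where
  "inner_das p C = Proj_Sup C {q \<in> Proj C. q \<preceq> p}"


section \<open>Gelfand spectra and the spectral bundle\<close>

text \<open>Characters of \<open>C\<close> are functions that are \<open>undefined\<close> outside \<open>C\<close>, so that distinct characters
  are distinct functions, restriction to \<open>D \<subseteq> C\<close> is \<^const>\<open>restrict\<close>, and the weak-* topology
  is the subspace topology from the product space \<open>\<complex>\<^sup>C\<close>.\<close>

definition gelfand_spectrum :: "'n::finite cmat set \<Rightarrow> ('n cmat \<Rightarrow> complex) set" where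
  "gelfand_spectrum C = {\<omega>. \<omega> \<in> extensional C \<and> \<omega> (mat 1) = 1 \<and>
     (\<forall>x\<in>C. \<forall>y\<in>C. \<omega> (x + y) = \<omega> x + \<omega> y \<and> \<omega> (x ** y) = \<omega> x * \<omega> y) \<and>
     (\<forall>z. \<forall>x\<in>C. \<omega> (mat z ** x) = z * \<omega> x)}"

definition gelfand_topology :: "'n::finite cmat set \<Rightarrow> ('n cmat \<Rightarrow> complex) topology" where
  "gelfand_topology C =
     subtopology (product_topology (\<lambda>_. euclidean) C) (gelfand_spectrum C)"

type_synonym 'n sigma_point = "'n cmat set \<times> ('n cmat \<Rightarrow> complex)"

definition Sigma_up :: "'n::finite sigma_point set" where
  "Sigma_up = Sigma contexts gelfand_spectrum"

definition fibre :: "'n::finite sigma_point set \<Rightarrow> 'n cmat set \<Rightarrow> ('n cmat \<Rightarrow> complex) set" where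
  "fibre U C = {\<omega>. (C, \<omega>) \<in> U}"

definition Sigma_up_topology :: "'n::finite sigma_point topology" where
  "Sigma_up_topology = topology (\<lambda>U. U \<subseteq> Sigma_up \<and>
     (\<forall>C\<in>contexts. \<forall>D\<in>contexts. D \<subseteq> C \<longrightarrow>
        (\<forall>\<omega>\<in>gelfand_spectrum C. restrict \<omega> D \<in> fibre U D \<longrightarrow> \<omega> \<in> fibre U C)) \<and>
     (\<forall>C\<in>contexts. openin (gelfand_topology C) (fibre U C)))"

lemma openin_Sigma_up_topology:
  "openin Sigma_up_topology U \<longleftrightarrow> U \<subseteq> Sigma_up \<and>
     (\<forall>C\<in>contexts. \<forall>D\<in>contexts. D \<subseteq> C \<longrightarrow>
        (\<forall>\<omega>\<in>gelfand_spectrum C. restrict \<omega> D \<in> fibre U D \<longrightarrow> \<omega> \<in> fibre U C)) \<and>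
     (\<forall>C\<in>contexts. openin (gelfand_topology C) (fibre U C))"
proof -
  have Int: "fibre (S \<inter> T) C = fibre S C \<inter> fibre T C"
    for S T :: "'a sigma_point set" and C by (auto simp: fibre_def)
  have Un: "fibre (\<Union>\<K>) C = (\<Union>K\<in>\<K>. fibre K C)"
    for \<K> :: "'a sigma_point set set" and C by (auto simp: fibre_def)
  let ?L = "\<lambda>U :: 'a sigma_point set. U \<subseteq> Sigma_up \<and>
     (\<forall>C\<in>contexts. \<forall>D\<in>contexts. D \<subseteq> C \<longrightarrow>
        (\<forall>\<omega>\<in>gelfand_spectrum C. restrict \<omega> D \<in> fibre U D \<longrightarrow> \<omega> \<in> fibre U C)) \<and>
     (\<forall>C\<in>contexts. openin (gelfand_topology C) (fibre U C))"
  have "?L (S \<inter> T)" if S: "?L S" and T: "?L T" for S T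
    unfolding Int
  proof (intro conjI ballI impI)
    show "S \<inter> T \<subseteq> Sigma_up" using S by blast
  next
    fix C D :: "'a cmat set" and \<omega>
    assume *: "C \<in> contexts" "D \<in> contexts" "D \<subseteq> C" "\<omega> \<in> gelfand_spectrum C"
      and "restrict \<omega> D \<in> fibre S D \<inter> fibre T D"
    then have r: "restrict \<omega> D \<in> fibre S D" "restrict \<omega> D \<in> fibre T D" by simp_all
    have "\<omega> \<in> fibre S C" using S[THEN conjunct2, THEN conjunct1] * r(1) by simp
    moreover have "\<omega> \<in> fibre T C" using T[THEN conjunct2, THEN conjunct1] * r(2) by simp
    ultimately show "\<omega> \<in> fibre S C \<inter> fibre T C" by (rule IntI)
  next
    fix C :: "'a cmat set" assume "C \<in> contexts"
    then show "openin (gelfand_topology C) (fibre S C \<inter> fibre T C)"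
      using S T by (intro openin_Int) simp_all
  qed
  moreover have "?L (\<Union>\<K>)" if K: "\<forall>K\<in>\<K>. ?L K" for \<K>
    unfolding Un
  proof (intro conjI ballI impI)
    show "\<Union>\<K> \<subseteq> Sigma_up" using K by (intro Union_least) simp
  next
    fix C D :: "'a cmat set" and \<omega>
    assume *: "C \<in> contexts" "D \<in> contexts" "D \<subseteq> C" "\<omega> \<in> gelfand_spectrum C"
      and "restrict \<omega> D \<in> (\<Union>K\<in>\<K>. fibre K D)"
    then obtain K where "K \<in> \<K>" and r: "restrict \<omega> D \<in> fibre K D" by (elim UN_E)
    have "\<omega> \<in> fibre K C"
      using K[rule_format, OF \<open>K \<in> \<K>\<close>, THEN conjunct2, THEN conjunct1] * r by simp
    with \<open>K \<in> \<K>\<close> show "\<omega> \<in> (\<Union>K\<in>\<K>. fibre K C)" by (rule UN_I)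
  next
    fix C :: "'a cmat set" assume "C \<in> contexts"
    then have "openin (gelfand_topology C) (fibre K C)" if "K \<in> \<K>" for K
      using K[rule_format, OF that] by simp
    then show "openin (gelfand_topology C) (\<Union>K\<in>\<K>. fibre K C)"
      by (intro openin_Union) auto
  qed
  ultimately have "istopology ?L"
    unfolding istopology_def by (intro conjI allI impI) simp_all
  then show ?thesis
    unfolding Sigma_up_topology_def by (simp only: topology_inverse')
qed

definition heyting_neg :: "'n::finite sigma_point set \<Rightarrow> 'n sigma_point set" where
  "heyting_neg U = \<Union>{V. openin Sigma_up_topology V \<and> V \<inter> U = {}}"

definition elem_prop :: "'n::finite cmat \<Rightarrow> real set \<Rightarrow> 'n sigma_point set" where
  "elem_prop a \<Delta> =
     {(C, \<omega>) \<in> Sigma_up. \<omega> (inner_das (spectral_projection a \<Delta>) C) = 1}"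


section \<open>The internal valuation of a state\<close>

text \<open>The Riesz--Markov measure: the unique Radon probability measure on the Borel sets of the
  spectrum whose integral functional is \<open>\<psi>\<close> restricted to \<open>C\<close>, an element \<open>x\<close> of \<open>C\<close> being
  identified with its Gelfand transform \<open>\<omega> \<mapsto> \<omega>(x)\<close>.\<close>

definition riesz_measure ::
  "('n::finite cmat \<Rightarrow> complex) \<Rightarrow> 'n cmat set \<Rightarrow> ('n cmat \<Rightarrow> complex) measure" where
  "riesz_measure \<psi> C = (THE M. prob_space M \<and>
     sets M = sigma_sets (gelfand_spectrum C) {U. openin (gelfand_topology C) U} \<and>
     (\<forall>B\<in>sets M. measure M B =
        (SUP K\<in>{K. compactin (gelfand_topology C) K \<and> K \<subseteq> B}. measure M K)) \<and>
     (\<forall>x\<in>C. (\<integral>\<omega>. \<omega> x \<partial>M) = \<psi> x))"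

definition int_valuation ::
  "('n::finite cmat \<Rightarrow> complex) \<Rightarrow> 'n sigma_point set \<Rightarrow> 'n cmat set \<Rightarrow> real" where
  "int_valuation \<psi> U C = measure (riesz_measure \<psi> C) (fibre U C)"

text \<open>Forcing, at stage \<open>C\<close> of the copresheaf topos, of an equality between two real-valued
  families indexed by contexts.\<close>

definition forces_eq ::
  "'n::finite cmat set \<Rightarrow> ('n cmat set \<Rightarrow> real) \<Rightarrow> ('n cmat set \<Rightarrow> real) \<Rightarrow> bool" where
  "forces_eq C f g \<longleftrightarrow> (\<forall>E\<in>contexts. C \<subseteq> E \<longrightarrow> f E = g E)"

end

theory Submission
  imports Defs "HOL-Computational_Algebra.Fundamental_Theorem_Algebra"
begin

text \<open>Over a maximal context \<open>C\<close> nothing larger constrains an open set, so the fibre of the negation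
  at \<open>C\<close> is the complement of the fibre of the proposition, namely the characters taking the value \<open>1\<close>
  at \<open>1 - d\<close>, where \<open>d\<close> is the inner daseinisation. Its measure is therefore \<open>\<psi> (1 - d)\<close>, and the first
  condition says \<open>\<psi> d = 0\<close>; since \<open>d\<close> is the largest projection of \<open>C\<close> below the spectral projection,
  this is the second condition by monotonicity of \<open>\<psi>\<close>. The third is the second applied to \<open>1 - p\<close>.

  Both the spectral theorem for \<open>a\<close> and the finiteness of the Gelfand spectrum of \<open>C\<close> come from one
  fact: a vector orthogonal to all joint eigenvectors of a commuting family closed under adjoints
  vanishes. Throughout, \<open>\<bullet>\<close> is the real inner product of \<open>complex^'n\<close>, the real part of the hermitian one;
  it determines adjoints, and on complex subspaces it yields the same orthogonality.\<close>


section \<open>Adjoints and orthogonal projections\<close>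

lemma inner_adj:
  fixes x :: "'n::finite cmat"
  shows "(adj x *v u) \<bullet> v = u \<bullet> (x *v v)"
proof -
  have "(adj x *v u) \<bullet> v = (\<Sum>i\<in>UNIV. \<Sum>j\<in>UNIV. (cnj (x $ j $ i) * u $ j) \<bullet> (v $ i))"
    by (simp add: inner_vec_def matrix_vector_mult_def adj_def inner_sum_left)
  also have "\<dots> = (\<Sum>j\<in>UNIV. \<Sum>i\<in>UNIV. (cnj (x $ j $ i) * u $ j) \<bullet> (v $ i))"
    by (rule sum.swap)
  also have "\<dots> = (\<Sum>j\<in>UNIV. \<Sum>i\<in>UNIV. (u $ j) \<bullet> (x $ j $ i * v $ i))"
    by (simp add: inner_complex_def algebra_simps)
  also have "\<dots> = u \<bullet> (x *v v)"
    by (simp add: inner_vec_def matrix_vector_mult_def inner_sum_right)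
  finally show ?thesis .
qed

lemma inner_smult_left:
  fixes u v :: "complex^'n::finite"
  shows "(c *s u) \<bullet> v = u \<bullet> (cnj c *s v)"
  by (simp add: inner_vec_def inner_complex_def algebra_simps)

text \<open>A vector is determined by its real inner products with all vectors, so the real form of
  the adjoint identity already fixes the matrix.\<close>

lemma adj_unique:
  fixes x y :: "'n::finite cmat"
  assumes "\<And>u v. (y *v u) \<bullet> v = u \<bullet> (x *v v)"
  shows "adj x = y"
  unfolding matrix_eq using assms inner_adj vector_eq_rdot by (metis inner_commute)

lemma adj_adj [simp]: "adj (adj x) = x"
  by (simp add: adj_def vec_eq_iff)

lemma adj_mult: "adj (x ** y) = adj y ** adj x"
  by (rule adj_unique) (simp add: inner_adj flip: matrix_vector_mul_assoc)

lemma adj_mat [simp]: "adj (mat c) = mat (cnj c)"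
  by (auto simp: adj_def mat_def vec_eq_iff)

lemma adj_add: "adj (x + y) = adj x + adj y"
  and adj_diff: "adj (x - y) = adj x - adj y"
  by (simp_all add: adj_def vec_eq_iff)

lemma adj_zero [simp]: "adj 0 = 0"
  by (simp add: adj_def vec_eq_iff)

lemma mat_mult_vec: "mat z *v v = z *s (v :: 'a::semiring_1^'n::finite)"
  by (simp add: vec_eq_iff matrix_vector_mult_def mat_def if_distrib if_distribR cong: if_cong)

section \<open>Algebra and order of projections\<close>

lemma is_projection_adj: "is_projection p \<Longrightarrow> adj p = p"
  by (simp add: is_projection_def self_adjoint_def)

lemma is_projection_idem: "is_projection p \<Longrightarrow> p ** p = p"
  by (simp add: is_projection_def)

lemma is_projection_zero: "is_projection 0"
  by (simp add: is_projection_def self_adjoint_def)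

lemma inner_projection: "is_projection p \<Longrightarrow> (p *v u) \<bullet> v = u \<bullet> (p *v v)"
  by (metis inner_adj is_projection_adj)

lemma projection_in_range:
  assumes "is_projection p"
  shows "v \<in> range ((*v) p) \<longleftrightarrow> p *v v = v"
proof
  assume "v \<in> range ((*v) p)"
  then obtain u where "v = p *v u" by blast
  then show "p *v v = v" by (simp add: matrix_vector_mul_assoc is_projection_idem[OF assms])
qed (metis rangeI)

lemma matrix_mult_diff_right: "x ** (y - z) = x ** y - x ** z"
  and matrix_mult_diff_left: "(y - z) ** x = y ** x - z ** x"
  for x y z :: "'n::finite cmat"
  by (simp_all add: matrix_eq matrix_vector_mult_diff_distrib matrix_vector_mult_diff_rdistrib
      flip: matrix_vector_mul_assoc)

lemma is_projection_compl:
  assumes "is_projection p"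
  shows "is_projection (mat 1 - p)"
  using assms by (simp add: is_projection_def self_adjoint_def adj_diff matrix_mult_diff_right matrix_mult_diff_left)

lemma positive_projection: "is_projection p \<Longrightarrow> positive_elt p"
  by (metis is_projection_adj is_projection_idem positive_elt_def)

lemma positive_inner:
  assumes "positive_elt x"
  shows "v \<bullet> (x *v v) \<ge> 0"
proof -
  obtain b where "x = adj b ** b" using assms by (auto simp: positive_elt_def)
  then have "v \<bullet> (x *v v) = (b *v v) \<bullet> (b *v v)"
    by (metis inner_adj inner_commute matrix_vector_mul_assoc)
  then show ?thesis by simp
qed

text \<open>This turns the order into algebra. If \<open>p\<close> absorbs \<open>q\<close>, then
  \<open>p - q\<close> is itself a projection, hence positive. Conversely, on the range of
  \<open>mat 1 - p\<close> the quadratic form of \<open>p - q\<close> is minus the squared norm of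
  \<open>q *v v\<close>, so positivity forces \<open>q\<close> to vanish there.\<close>

lemma projection_le_iff:
  assumes q: "is_projection q" and p: "is_projection p"
  shows "q \<preceq> p \<longleftrightarrow> p ** q = q"
proof
  assume pq: "p ** q = q"
  then have qp: "q ** p = q"
    by (metis adj_mult is_projection_adj p q)
  have "is_projection (p - q)"
    using p q pq qp
    by (simp add: is_projection_def self_adjoint_def adj_diff matrix_mult_diff_right matrix_mult_diff_left)
  then show "q \<preceq> p"
    unfolding le_elt_def by (rule positive_projection)
next
  assume "q \<preceq> p"
  then have pos: "v \<bullet> ((p - q) *v v) \<ge> 0" for v
    by (simp add: le_elt_def positive_inner)
  have "q ** (mat 1 - p) = 0"
    unfolding matrix_eq
  proof
    fix w
    let ?v = "(mat 1 - p) *v w"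
    have "p *v ?v = 0"
      by (simp add: matrix_vector_mul_assoc matrix_mult_diff_right is_projection_idem[OF p])
    then have "0 \<le> - (?v \<bullet> (q *v ?v))"
      using pos[of ?v] by (simp add: matrix_vector_mult_diff_rdistrib)
    also have "?v \<bullet> (q *v ?v) = (q *v ?v) \<bullet> (q *v ?v)"
      by (metis inner_projection is_projection_idem matrix_vector_mul_assoc q)
    finally have "q *v ?v = 0"
      by (metis inner_eq_zero_iff inner_ge_zero neg_0_le_iff_le order_antisym)
    then show "q ** (mat 1 - p) *v w = 0 *v w"
      by (simp add: matrix_vector_mul_assoc)
  qed
  then have "q = q ** p" by (simp add: matrix_mult_diff_right)
  then show "p ** q = q"
    by (metis adj_mult is_projection_adj p q)
qed

lemma le_elt_antisym:
  assumes "is_projection q" "is_projection p" "q \<preceq> p" "p \<preceq> q"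
  shows "q = p"
  using assms by (metis adj_mult is_projection_adj projection_le_iff)

text \<open>The description has the same shape as the one in \<open>eigenprojection\<close>, which
  thereby becomes an instance by unfolding. The joint eigenspaces of a context are the other
  instance.\<close>

definition proj_onto :: "(complex^'n::finite) set \<Rightarrow> 'n cmat" where
  "proj_onto W = (THE p. is_projection p \<and> range ((*v) p) = W)"

text \<open>Each projection fixes the range of the other, which gives two product identities; taking
  adjoints makes them agree. The description operators for projections are well defined because of
  this.\<close>

lemma projection_range_unique:
  assumes p: "is_projection p" and q: "is_projection q"
    and eq: "range ((*v) p) = range ((*v) q)"
  shows "p = q"
proof -
  have "p ** q = q" "q ** p = p"
    unfolding matrix_eq using projection_in_range[OF p] projection_in_range[OF q] eq
    by (metis matrix_vector_mul_assoc rangeI)+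
  then show ?thesis
    by (metis adj_mult is_projection_adj p q)
qed

text \<open>The real orthogonal projection onto \<open>W\<close> exists by the real decomposition
  theorem. It is complex linear because \<open>W\<close> is closed under complex scalars, which
  cross the inner product as conjugates.\<close>

lemma proj_onto_exists:
  assumes W: "vec.subspace W"
  shows "\<exists>p. is_projection p \<and> range ((*v) p) = W"
proof -
  have scale: "c *\<^sub>R v = complex_of_real c *s v" for c and v :: "complex^'n"
    by (simp add: vec_eq_iff scaleR_conv_of_real[where 'a = complex])
  have "subspace W"
    using W by (auto simp: subspace_def vec.subspace_def scale)
  then have span: "span W = W" by (simp add: span_eq_iff)
  have "\<exists>y. y \<in> W \<and> (\<forall>w\<in>W. (x - y) \<bullet> w = 0)" for x
    using orthogonal_subspace_decomp_exists[of W x] unfolding span orthogonal_def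
    by (metis add_diff_cancel_left')
  then obtain f where f: "f x \<in> W" "w \<in> W \<Longrightarrow> (x - f x) \<bullet> w = 0" for x w
    by metis
  have uniq: "f x = y" if "y \<in> W" "\<And>w. w \<in> W \<Longrightarrow> (x - y) \<bullet> w = 0" for x y
  proof -
    have "f x - y \<in> W" using W f that vec.subspace_diff by blast
    then have "(f x - y) \<bullet> (f x - y) = (x - y) \<bullet> (f x - y) - (x - f x) \<bullet> (f x - y)"
      by (simp add: inner_diff_left)
    also have "\<dots> = 0" using f that \<open>f x - y \<in> W\<close> by simp
    finally show ?thesis by simp
  qed
  have "Vector_Spaces.linear (*s) (*s) f"
  proof unfold_locales
    fix x y
    have "x + y - (f x + f y) = (x - f x) + (y - f y)" by simp
    then have "(x + y - (f x + f y)) \<bullet> w = 0" if "w \<in> W" for w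
      using f(2)[OF that, of x] f(2)[OF that, of y] by (simp only: inner_add_left)
    then show "f (x + y) = f x + f y"
      by (intro uniq vec.subspace_add[OF W] f(1))
  next
    fix c x
    have "(c *s x - c *s f x) \<bullet> w = 0" if "w \<in> W" for w
    proof -
      have "c *s x - c *s f x = c *s (x - f x)" by (simp add: vec.scale_right_diff_distrib)
      then have "(c *s x - c *s f x) \<bullet> w = (x - f x) \<bullet> (cnj c *s w)"
        by (simp only: inner_smult_left)
      then show ?thesis using f W that by (simp add: vec.subspace_scale)
    qed
    then show "f (c *s x) = c *s f x"
      using f W by (intro uniq) (auto simp: vec.subspace_scale)
  qed
  then have m: "matrix f *v x = f x" for x by (rule matrix_works)
  have id: "f w = w" if "w \<in> W" for w using that by (intro uniq) auto
  \<comment> \<open>Both sides equal the inner product of \<open>f u\<close> with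
    \<open>f v\<close>, since the residuals \<open>u - f u\<close> and \<open>v - f v\<close> are
    orthogonal to \<open>W\<close>.\<close>
  have "f u \<bullet> v = u \<bullet> f v" for u v
    using f(2)[OF f(1), of u v] f(2)[OF f(1), of v u]
      inner_commute[of v "f u"] inner_commute[of "f v" "f u"]
    by (simp add: inner_diff_left)
  then have "adj (matrix f) = matrix f" by (intro adj_unique) (simp add: m)
  moreover have "matrix f ** matrix f = matrix f"
    unfolding matrix_eq by (simp add: m id f flip: matrix_vector_mul_assoc)
  moreover have "range ((*v) (matrix f)) = W"
    unfolding m using f(1) id by (auto simp: image_iff) metis
  ultimately show ?thesis
    unfolding is_projection_def self_adjoint_def by blast
qed

lemma proj_onto:
  assumes "vec.subspace W"
  shows is_projection_proj_onto: "is_projection (proj_onto W)"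
    and range_proj_onto: "range ((*v) (proj_onto W)) = W"
proof -
  obtain p where "is_projection p \<and> range ((*v) p) = W"
    using proj_onto_exists[OF assms] by blast
  then have "is_projection (proj_onto W) \<and> range ((*v) (proj_onto W)) = W"
    unfolding proj_onto_def by (rule theI) (use projection_range_unique \<open>is_projection p \<and> _\<close> in blast)
  then show "is_projection (proj_onto W)" "range ((*v) (proj_onto W)) = W" by auto
qed

lemma proj_onto_fix_iff:
  assumes "vec.subspace W"
  shows "proj_onto W *v v = v \<longleftrightarrow> v \<in> W"
  using projection_in_range[OF is_projection_proj_onto[OF assms]] range_proj_onto[OF assms] by metis

lemma proj_onto_in: "vec.subspace W \<Longrightarrow> proj_onto W *v v \<in> W"
  using range_proj_onto by blast

text \<open>Write \<open>p\<close> for the projection. Invariance under \<open>y\<close> gives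
  \<open>p ** y ** p = y ** p\<close>; invariance under \<open>adj y\<close>, after taking adjoints,
  gives \<open>p ** y ** p = p ** y\<close>.\<close>

lemma proj_onto_commute:
  assumes W: "vec.subspace W"
    and y: "\<And>w. w \<in> W \<Longrightarrow> y *v w \<in> W" and y': "\<And>w. w \<in> W \<Longrightarrow> adj y *v w \<in> W"
  shows "proj_onto W ** y = y ** proj_onto W"
proof -
  let ?p = "proj_onto W"
  have *: "?p ** z ** ?p = z ** ?p" if "\<And>w. w \<in> W \<Longrightarrow> z *v w \<in> W" for z
    unfolding matrix_eq using that W
    by (simp add: proj_onto_fix_iff proj_onto_in flip: matrix_vector_mul_assoc)
  have "?p ** y = adj (adj y ** ?p)"
    by (simp add: adj_mult is_projection_adj is_projection_proj_onto W)
  also have "\<dots> = adj (?p ** adj y ** ?p)" by (simp add: * y')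
  also have "\<dots> = ?p ** y ** ?p"
    by (simp add: adj_mult is_projection_adj is_projection_proj_onto W matrix_mul_assoc)
  also have "\<dots> = y ** ?p" by (simp add: * y)
  finally show ?thesis .
qed

lemma proj_onto_orthogonal:
  assumes V: "vec.subspace V" and W: "vec.subspace W"
    and orth: "\<And>v w. v \<in> V \<Longrightarrow> w \<in> W \<Longrightarrow> v \<bullet> w = 0"
  shows "proj_onto V ** proj_onto W = 0"
proof -
  have "(proj_onto V *v (proj_onto W *v u)) \<bullet> v = 0" for u v
    using orth[OF proj_onto_in[OF V, of v] proj_onto_in[OF W, of u]]
    by (metis V inner_commute inner_projection is_projection_proj_onto)
  then have "proj_onto V *v (proj_onto W *v u) = 0" for u
    by (metis inner_eq_zero_iff)
  then show ?thesis by (simp add: matrix_eq matrix_vector_mul_assoc)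
qed


section \<open>Joint eigenvectors of commuting families\<close>

text \<open>This is the vector \<open>p(x) v\<close> in Horner form, so that matrix powers never
  have to be defined.\<close>

definition poly_act :: "'n::finite cmat \<Rightarrow> complex^'n \<Rightarrow> complex poly \<Rightarrow> complex^'n" where
  "poly_act x v p = fold_coeffs (\<lambda>c w. c *s v + x *v w) p 0"

lemma poly_act_0 [simp]: "poly_act x v 0 = 0"
  by (simp add: poly_act_def)

lemma poly_act_pCons [simp]: "poly_act x v (pCons c p) = c *s v + x *v poly_act x v p"
  by (cases "p = 0 \<and> c = 0") (auto simp: poly_act_def)

lemma poly_act_add: "poly_act x v (p + q) = poly_act x v p + poly_act x v q"
  by (induction p q rule: poly_induct2) (simp_all add: matrix_vector_right_distrib vec.scale_left_distrib)

lemma poly_act_smult: "poly_act x v (smult c p) = c *s poly_act x v p"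
  by (induction p) (simp_all add: vector_scalar_commute vec.scale_right_distrib)

lemma poly_act_diff: "poly_act x v (p - q) = poly_act x v p - poly_act x v q"
  using poly_act_add[of x v "p - q" q] by simp

lemma poly_act_sum: "poly_act x v (\<Sum>i\<in>I. f i) = (\<Sum>i\<in>I. poly_act x v (f i))"
  by (induction I rule: infinite_finite_induct) (simp_all add: poly_act_add)

lemma poly_act_monom: "poly_act x v (monom c i) = c *s poly_act x v (monom 1 i)"
  by (metis mult.right_neutral poly_act_smult smult_monom)

lemma poly_act_in:
  assumes "vec.subspace W" "\<And>w. w \<in> W \<Longrightarrow> x *v w \<in> W" "v \<in> W"
  shows "poly_act x v p \<in> W"
  by (induction p) (use assms in \<open>auto simp: vec.subspace_0 vec.subspace_add vec.subspace_scale\<close>)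

lemma annihilating_poly_exists: "\<exists>q. q \<noteq> 0 \<and> poly_act x v q = 0"
proof -
  let ?f = "\<lambda>i. poly_act x v (monom 1 i)"
  show ?thesis
  \<comment> \<open>The indices run from 0 to the dimension inclusive, one more than can be
    independent. Dependence is a property of the set of vectors, so a coincidence between two of
    them is treated apart: there a difference of two monomials annihilates \<open>v\<close>.\<close>
  proof (cases "inj_on ?f {..CARD('a)}")
    case False
    then obtain i j where ij: "i \<noteq> j" "?f i = ?f j" by (auto simp: inj_on_def)
    then have "coeff (monom 1 i - monom (1::complex) j) i \<noteq> 0" by simp
    then have "monom 1 i - monom (1::complex) j \<noteq> 0" by (metis coeff_0)
    then show ?thesis using ij by (metis poly_act_diff right_minus_eq)
  next
    case True
    then have "card (?f ` {..CARD('a)}) = Suc CARD('a)" by (simp add: card_image)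
    then have "vec.dependent (?f ` {..CARD('a)})"
      using vec.independent_card_le_dim[of "?f ` {..CARD('a)}" UNIV]
      by (metis Suc_n_not_le_n subset_UNIV vec_dim_card)
    then obtain S u where S: "finite S" "S \<subseteq> ?f ` {..CARD('a)}" "(\<Sum>w\<in>S. u w *s w) = 0"
      and ex: "\<exists>w\<in>S. u w \<noteq> 0"
      unfolding vec.dependent_explicit by blast
    from S(2) obtain I where I: "I \<subseteq> {..CARD('a)}" "S = ?f ` I"
      by (meson subset_imageE)
    have inj: "inj_on ?f I" using True I(1) by (rule inj_on_subset)
    have fin: "finite I" using I(1) finite_subset by blast
    define q where "q = (\<Sum>i\<in>I. monom (u (?f i)) i)"
    have "poly_act x v q = (\<Sum>i\<in>I. u (?f i) *s ?f i)"
      unfolding q_def poly_act_sum by (subst poly_act_monom) (rule refl)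
    also have "\<dots> = 0" using S(3) unfolding I(2) by (simp add: sum.reindex[OF inj])
    finally have "poly_act x v q = 0" .
    moreover obtain i where i: "i \<in> I" "u (?f i) \<noteq> 0" using ex I(2) by blast
    then have "coeff q i = u (?f i)"
      using fin by (simp add: q_def coeff_sum sum.delta)
    then have "q \<noteq> 0" using i by auto
    ultimately show ?thesis by blast
  qed
qed

text \<open>An annihilating polynomial of minimal degree has a root \<open>r\<close>, and removing that factor leaves
  a vector killed by \<open>x - r\<close>.\<close>

lemma invariant_subspace_eigenvector:
  fixes x :: "'n::finite cmat"
  assumes W: "vec.subspace W" and inv: "\<And>w. w \<in> W \<Longrightarrow> x *v w \<in> W"
    and v: "v \<in> W" "v \<noteq> 0"
  obtains c w where "w \<in> W" "w \<noteq> 0" "x *v w = c *s w"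
proof -
  obtain q where q: "q \<noteq> 0" "poly_act x v q = 0"
    and least: "\<And>p. p \<noteq> 0 \<Longrightarrow> poly_act x v p = 0 \<Longrightarrow> degree q \<le> degree p"
    using ex_has_least_nat[of "\<lambda>q. q \<noteq> 0 \<and> poly_act x v q = 0" _ degree]
      annihilating_poly_exists[of x v] by metis
  have "degree q \<noteq> 0"
  proof
    assume "degree q = 0"
    then obtain c where "q = [:c:]" by (rule degree_eq_zeroE)
    then show False using q v by auto
  qed
  then obtain r where "poly q r = 0"
    using fundamental_theorem_of_algebra[of q] by (auto simp: constant_degree)
  then obtain p where p: "q = [:-r, 1:] * p" by (auto simp: poly_eq_0_iff_dvd dvd_def)
  then have "p \<noteq> 0" using q by auto
  then have "degree q = Suc (degree p)"
    unfolding p by (subst degree_mult_eq) auto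
  then have "poly_act x v p \<noteq> 0" using least[OF \<open>p \<noteq> 0\<close>] by auto
  moreover have "x *v poly_act x v p = r *s poly_act x v p"
    using q(2) unfolding p by (simp add: poly_act_add poly_act_diff poly_act_smult)
  ultimately show ?thesis using that poly_act_in[OF W inv v(1)] by blast
qed

definition joint_eigenvector :: "'n::finite cmat set \<Rightarrow> complex^'n \<Rightarrow> bool" where
  "joint_eigenvector S v \<longleftrightarrow> (\<forall>x\<in>S. \<exists>c. x *v v = c *s v)"

text \<open>An invariant subspace of minimal positive dimension consists of joint eigenvectors, because
  it equals each of its nonzero eigenspaces.\<close>

lemma invariant_subspace_joint_eigenvector:
  fixes S :: "'n::finite cmat set"
  assumes comm: "\<And>x y. x \<in> S \<Longrightarrow> y \<in> S \<Longrightarrow> x ** y = y ** x"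
    and W: "vec.subspace W" and inv: "\<And>x w. x \<in> S \<Longrightarrow> w \<in> W \<Longrightarrow> x *v w \<in> W"
    and v: "v \<in> W" "v \<noteq> 0"
  obtains w where "w \<in> W" "w \<noteq> 0" "joint_eigenvector S w"
proof -
  define P where "P V \<longleftrightarrow> vec.subspace V \<and> V \<subseteq> W \<and> (\<forall>x\<in>S. \<forall>w\<in>V. x *v w \<in> V) \<and> (\<exists>v\<in>V. v \<noteq> 0)"
    for V
  have "P W" unfolding P_def using W inv v by auto
  then obtain V where PV: "P V" and least: "\<And>U. P U \<Longrightarrow> vec.dim V \<le> vec.dim U"
    using ex_has_least_nat[of P W vec.dim] by metis
  have V: "vec.subspace V" "V \<subseteq> W" and Vinv: "\<And>x w. x \<in> S \<Longrightarrow> w \<in> V \<Longrightarrow> x *v w \<in> V"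
    and "\<exists>v\<in>V. v \<noteq> 0"
    using PV unfolding P_def by blast+
  then obtain u where u: "u \<in> V" "u \<noteq> 0" by blast
  have "\<exists>c. x *v u = c *s u" if x: "x \<in> S" for x
  proof -
    obtain c w where w: "w \<in> V" "w \<noteq> 0" "x *v w = c *s w"
      by (rule invariant_subspace_eigenvector[OF V(1) Vinv[OF x] u])
    define U where "U = {z \<in> V. x *v z = c *s z}"
    have "vec.subspace U"
      using V(1) unfolding U_def vec.subspace_def
      by (auto simp: matrix_vector_right_distrib vec.scale_right_distrib vector_scalar_commute vec.scale_left_commute)
    moreover have "y *v z \<in> U" if "y \<in> S" "z \<in> U" for y z
    proof -
      have "x *v (y *v z) = y *v (x *v z)"
        by (simp add: matrix_vector_mul_assoc comm x that)
      then show ?thesis using Vinv that by (auto simp: U_def vector_scalar_commute)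
    qed
    moreover have "U \<subseteq> V" by (auto simp: U_def)
    moreover have "w \<in> U" using w by (simp add: U_def)
    ultimately have "P U" unfolding P_def using V(2) w(2) by blast
    then have "U = V"
      using least V(1) \<open>U \<subseteq> V\<close> by (intro vec.subspace_dim_equal) (auto simp: P_def)
    then show ?thesis using u by (auto simp: U_def)
  qed
  then show ?thesis using that[of u] u V by (auto simp: joint_eigenvector_def)
qed

text \<open>The orthogonal complement of all joint eigenvectors is invariant, because the family
  contains its adjoints. Were it nonzero, it would contain a nonzero joint eigenvector, which would
  be orthogonal to itself.\<close>

lemma orthogonal_joint_eigenvectors_zero:
  fixes S :: "'n::finite cmat set"
  assumes comm: "\<And>x y. x \<in> S \<Longrightarrow> y \<in> S \<Longrightarrow> x ** y = y ** x"
    and adj: "\<And>x. x \<in> S \<Longrightarrow> adj x \<in> S"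
    and orth: "\<And>v. joint_eigenvector S v \<Longrightarrow> u \<bullet> v = 0"
  shows "u = 0"
proof (rule ccontr)
  assume "u \<noteq> 0"
  define W where "W = {w. \<forall>v. joint_eigenvector S v \<longrightarrow> w \<bullet> v = 0}"
  \<comment> \<open>Closure under complex scaling is what makes the real orthogonal complement a
    complex subspace.\<close>
  have scale: "joint_eigenvector S (c *s v)" if v: "joint_eigenvector S v" for c v
    unfolding joint_eigenvector_def
  proof
    fix x assume "x \<in> S"
    then obtain d where "x *v v = d *s v" using v by (auto simp: joint_eigenvector_def)
    then have "x *v (c *s v) = d *s (c *s v)" by (simp add: vector_scalar_commute mult.commute)
    then show "\<exists>d. x *v (c *s v) = d *s (c *s v)" ..
  qed
  have W: "vec.subspace W"
    unfolding W_def vec.subspace_def by (auto simp: inner_add_left inner_smult_left scale)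
  have inv: "x *v w \<in> W" if x: "x \<in> S" and w: "w \<in> W" for x w
    unfolding W_def
  proof (intro CollectI allI impI)
    fix v assume v: "joint_eigenvector S v"
    then obtain c where "adj x *v v = c *s v" using adj[OF x] by (auto simp: joint_eigenvector_def)
    then have "(x *v w) \<bullet> v = w \<bullet> (c *s v)" by (metis adj_adj inner_adj)
    then show "(x *v w) \<bullet> v = 0" using w scale[OF v] by (simp add: W_def)
  qed
  have u: "u \<in> W" using orth by (simp add: W_def)
  obtain w where "w \<in> W" "w \<noteq> 0" "joint_eigenvector S w"
    by (rule invariant_subspace_joint_eigenvector[OF comm W inv u \<open>u \<noteq> 0\<close>])
  then show False by (auto simp: W_def)
qed

text \<open>Nonzero fixed vectors, one for each projection, are pairwise orthogonal, hence
  independent in a finite-dimensional space. This bounds both the eigenvalues of a self-adjoint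
  matrix and the characters of a context.\<close>

lemma finite_orthogonal_projections:
  fixes f :: "'i \<Rightarrow> 'n::finite cmat"
  assumes proj: "\<And>i. i \<in> I \<Longrightarrow> is_projection (f i)" and nz: "\<And>i. i \<in> I \<Longrightarrow> f i \<noteq> 0"
    and orth: "\<And>i j. i \<in> I \<Longrightarrow> j \<in> I \<Longrightarrow> i \<noteq> j \<Longrightarrow> f i ** f j = 0"
  shows "finite I"
proof -
  have "\<exists>v. f i *v v = v \<and> v \<noteq> 0" if i: "i \<in> I" for i
  proof -
    obtain u where "f i *v u \<noteq> 0" using nz[OF i] by (auto simp: matrix_eq)
    then show ?thesis
      by (metis i is_projection_idem matrix_vector_mul_assoc proj)
  qed
  then obtain g where g: "\<And>i. i \<in> I \<Longrightarrow> f i *v g i = g i" "\<And>i. i \<in> I \<Longrightarrow> g i \<noteq> 0" by metis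
  have o: "g i \<bullet> g j = 0" if "i \<in> I" "j \<in> I" "i \<noteq> j" for i j
  proof -
    have "g i \<bullet> g j = g i \<bullet> (f i *v (f j *v g j))"
      by (metis g(1) inner_projection proj that)
    then show ?thesis by (simp add: matrix_vector_mul_assoc orth that)
  qed
  have "inj_on g I"
  proof (rule inj_onI, rule ccontr)
    fix i j assume "i \<in> I" "j \<in> I" "g i = g j" "i \<noteq> j"
    then show False using o[of i j] g(2)[of j] by simp
  qed
  moreover have "independent (g ` I)"
    using o g(2) by (intro pairwise_orthogonal_independent) (auto simp: pairwise_def orthogonal_def)
  then have "finite (g ` I)" by (rule independent_imp_finite)
  ultimately show ?thesis using finite_imageD by blast
qed

section \<open>Sums of orthogonal projections and resolutions of the identity\<close>

lemma matrix_add_rdistrib: "(y + z) ** x = y ** x + z ** x"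
  for x :: "'n::finite cmat"
  by (simp add: matrix_eq matrix_vector_mult_add_rdistrib flip: matrix_vector_mul_assoc)

lemma matrix_mult_sum_right: "x ** (\<Sum>i\<in>I. f i) = (\<Sum>i\<in>I. x ** f i)"
  and matrix_mult_sum_left: "(\<Sum>i\<in>I. f i) ** x = (\<Sum>i\<in>I. f i ** x)"
  for x :: "'n::finite cmat"
  by (induction I rule: infinite_finite_induct) (simp_all add: matrix_add_ldistrib matrix_add_rdistrib)

lemma is_projection_sum:
  fixes f :: "'i \<Rightarrow> 'n::finite cmat"
  assumes "finite I" and proj: "\<And>i. i \<in> I \<Longrightarrow> is_projection (f i)"
    and orth: "\<And>i j. i \<in> I \<Longrightarrow> j \<in> I \<Longrightarrow> i \<noteq> j \<Longrightarrow> f i ** f j = 0"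
  shows "is_projection (\<Sum>i\<in>I. f i)"
proof -
  have "adj (\<Sum>i\<in>I. f i) = (\<Sum>i\<in>I. adj (f i))"
    by (induction I rule: infinite_finite_induct) (simp_all add: adj_add)
  also have "\<dots> = (\<Sum>i\<in>I. f i)" by (simp add: proj is_projection_adj)
  finally have "self_adjoint (\<Sum>i\<in>I. f i)" by (simp add: self_adjoint_def)
  moreover have "(\<Sum>i\<in>I. f i) ** (\<Sum>i\<in>I. f i) = (\<Sum>i\<in>I. \<Sum>j\<in>I. if j = i then f i else 0)"
    unfolding matrix_mult_sum_left matrix_mult_sum_right
    by (intro sum.cong refl) (auto simp: orth proj is_projection_idem)
  ultimately show ?thesis using \<open>finite I\<close> by (simp add: is_projection_def)
qed

text \<open>The complement of the sum is a projection killing every joint eigenvector, so its range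
  is orthogonal to all of them and must vanish.\<close>

lemma sum_projections_eq_one:
  fixes S :: "'n::finite cmat set" and f :: "'i \<Rightarrow> 'n cmat"
  assumes comm: "\<And>x y. x \<in> S \<Longrightarrow> y \<in> S \<Longrightarrow> x ** y = y ** x"
    and adj: "\<And>x. x \<in> S \<Longrightarrow> adj x \<in> S"
    and fin: "finite I" and proj: "\<And>i. i \<in> I \<Longrightarrow> is_projection (f i)"
    and orth: "\<And>i j. i \<in> I \<Longrightarrow> j \<in> I \<Longrightarrow> i \<noteq> j \<Longrightarrow> f i ** f j = 0"
    and ex: "\<And>v. joint_eigenvector S v \<Longrightarrow> v \<noteq> 0 \<Longrightarrow> \<exists>i\<in>I. f i *v v = v"
  shows "(\<Sum>i\<in>I. f i) = mat 1"
proof -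
  let ?s = "\<Sum>i\<in>I. f i"
  have s: "is_projection ?s" using fin proj orth by (rule is_projection_sum)
  have sf: "?s ** f i = f i" if "i \<in> I" for i
  proof -
    have "?s ** f i = (\<Sum>j\<in>I. if j = i then f i else 0)"
      unfolding matrix_mult_sum_left
      by (intro sum.cong refl) (auto simp: orth that proj is_projection_idem)
    then show ?thesis using fin that by simp
  qed
  have "(mat 1 - ?s) *v u = 0" for u
  proof (rule orthogonal_joint_eigenvectors_zero[OF comm adj])
    fix v assume v: "joint_eigenvector S v"
    have "?s *v v = v"
    proof (cases "v = 0")
      case False
      then obtain i where "i \<in> I" "f i *v v = v" using ex v by blast
      then show ?thesis by (metis matrix_vector_mul_assoc sf)
    qed simp
    then show "((mat 1 - ?s) *v u) \<bullet> v = 0"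
      by (subst inner_projection[OF is_projection_compl[OF s]]) (simp add: matrix_vector_mult_diff_rdistrib)
  qed
  then show ?thesis
    by (simp add: matrix_eq matrix_vector_mult_diff_rdistrib)
qed


section \<open>Spectral projections and inner daseinisation\<close>

definition eigenspace :: "'n::finite cmat \<Rightarrow> real \<Rightarrow> (complex^'n) set" where
  "eigenspace a r = {v. a *v v = complex_of_real r *s v}"

lemma eigenprojection_eq: "eigenprojection a r = proj_onto (eigenspace a r)"
  by (simp add: eigenprojection_def proj_onto_def eigenspace_def)

lemma subspace_eigenspace: "vec.subspace (eigenspace a r)"
  unfolding eigenspace_def vec.subspace_def
  by (auto simp: matrix_vector_right_distrib vec.scale_right_distrib vector_scalar_commute
      vec.scale_left_commute)

lemma inner_self_adjoint: "self_adjoint a \<Longrightarrow> (a *v u) \<bullet> v = u \<bullet> (a *v v)"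
  by (metis inner_adj self_adjoint_def)

lemma eigenspace_orthogonal:
  assumes a: "self_adjoint a" and "r \<noteq> s" and v: "v \<in> eigenspace a r" and w: "w \<in> eigenspace a s"
  shows "v \<bullet> w = 0"
proof -
  have scale: "complex_of_real c *s u = c *\<^sub>R u" for c and u :: "complex^'a"
    by (simp add: vec_eq_iff scaleR_conv_of_real[where 'a = complex])
  have "r * (v \<bullet> w) = (a *v v) \<bullet> w" using v by (simp add: eigenspace_def scale)
  also have "\<dots> = v \<bullet> (a *v w)" by (rule inner_self_adjoint[OF a])
  also have "\<dots> = s * (v \<bullet> w)" using w by (simp add: eigenspace_def scale)
  finally show ?thesis using \<open>r \<noteq> s\<close> by simp
qed

text \<open>Testing self-adjointness against \<open>v\<close> gives nothing, since the real inner
  product is symmetric. Testing against \<open>\<i> *s v\<close> exposes the imaginary part of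
  \<open>c\<close>.\<close>

lemma self_adjoint_eigenvalue_real:
  assumes a: "self_adjoint a" and v: "a *v v = c *s v" "v \<noteq> 0"
  shows "c = complex_of_real (Re c)"
proof -
  have "v \<bullet> (cnj c *s (\<i> *s v)) = (a *v v) \<bullet> (\<i> *s v)" by (simp add: v inner_smult_left)
  also have "\<dots> = v \<bullet> (a *v (\<i> *s v))" by (rule inner_self_adjoint[OF a])
  also have "\<dots> = v \<bullet> (c *s (\<i> *s v))" by (simp add: vector_scalar_commute v mult.commute)
  finally have "0 = v \<bullet> ((c - cnj c) *s (\<i> *s v))"
    by (simp add: vec.scale_left_diff_distrib inner_diff_right left_diff_distrib)
  also have "(c - cnj c) *s (\<i> *s v) = (- 2 * Im c) *\<^sub>R v"
    by (simp add: vec_eq_iff complex_eq_iff)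
  finally have "Im c = 0" using v(2) by simp
  then show ?thesis by (simp add: complex_eq_iff)
qed

section \<open>The spectral theorem for a self-adjoint matrix\<close>

definition real_eigenvalues :: "'n::finite cmat \<Rightarrow> real set" where
  "real_eigenvalues a = {r. \<exists>v. v \<noteq> 0 \<and> v \<in> eigenspace a r}"

lemma spectral_projection_eq:
  "spectral_projection a \<Delta> = (\<Sum>r\<in>\<Delta> \<inter> real_eigenvalues a. proj_onto (eigenspace a r))"
  by (auto simp: spectral_projection_def eigenprojection_eq real_eigenvalues_def eigenspace_def
      intro!: sum.cong)

lemma eigenprojections_orthogonal:
  "self_adjoint a \<Longrightarrow> r \<noteq> s \<Longrightarrow> proj_onto (eigenspace a r) ** proj_onto (eigenspace a s) = 0"
  by (intro proj_onto_orthogonal subspace_eigenspace) (auto intro: eigenspace_orthogonal)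

lemma proj_onto_eq_0_imp:
  assumes "vec.subspace W" "proj_onto W = 0" "v \<in> W"
  shows "v = 0"
  using assms proj_onto_fix_iff[of W v] by simp

lemma finite_real_eigenvalues:
  assumes "self_adjoint a"
  shows "finite (real_eigenvalues a)"
proof (rule finite_orthogonal_projections)
  fix r assume "r \<in> real_eigenvalues a"
  then show "proj_onto (eigenspace a r) \<noteq> 0"
    using proj_onto_eq_0_imp[OF subspace_eigenspace] by (auto simp: real_eigenvalues_def)
qed (auto simp: is_projection_proj_onto subspace_eigenspace eigenprojections_orthogonal assms)

lemma is_projection_spectral_projection:
  assumes "self_adjoint a"
  shows "is_projection (spectral_projection a \<Delta>)"
  unfolding spectral_projection_eq
  by (rule is_projection_sum)
    (auto simp: finite_real_eigenvalues is_projection_proj_onto subspace_eigenspace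
      eigenprojections_orthogonal assms)

text \<open>A nonzero joint eigenvector of \<open>{a}\<close> is an eigenvector of \<open>a\<close>
  with real eigenvalue, so one of the eigenprojections fixes it and they resolve the
  identity.\<close>

lemma spectral_projection_UNIV:
  assumes a: "self_adjoint a"
  shows "spectral_projection a UNIV = mat 1"
  unfolding spectral_projection_eq
proof (rule sum_projections_eq_one[of "{a}"])
  fix v assume v: "joint_eigenvector {a} v" "v \<noteq> 0"
  then obtain c where c: "a *v v = c *s v" by (auto simp: joint_eigenvector_def)
  then have "v \<in> eigenspace a (Re c)"
    using self_adjoint_eigenvalue_real[OF a c v(2)] by (simp add: eigenspace_def)
  then show "\<exists>r\<in>UNIV \<inter> real_eigenvalues a. proj_onto (eigenspace a r) *v v = v"
    using v(2) by (auto simp: real_eigenvalues_def proj_onto_fix_iff subspace_eigenspace)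
qed (use a in \<open>auto simp: self_adjoint_def finite_real_eigenvalues is_projection_proj_onto
      subspace_eigenspace eigenprojections_orthogonal\<close>)

text \<open>The finite sum over all eigenvalues splits along \<open>\<Delta>\<close>. This connects
  the third condition of the theorem with the second.\<close>

lemma spectral_projection_compl:
  assumes a: "self_adjoint a"
  shows "spectral_projection a (UNIV - \<Delta>) = mat 1 - spectral_projection a \<Delta>"
proof -
  have "spectral_projection a UNIV = spectral_projection a (UNIV - \<Delta>) + spectral_projection a \<Delta>"
    unfolding spectral_projection_eq
    by (subst sum.union_disjoint[symmetric])
      (auto simp: finite_real_eigenvalues[OF a] intro!: sum.cong)
  then show ?thesis by (simp add: spectral_projection_UNIV[OF a] algebra_simps)
qed

section \<open>Contexts and the largest projection below a given one\<close>

context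
  fixes C :: "'n::finite cmat set"
  assumes C: "C \<in> contexts"
begin

lemma context_commute: "x \<in> C \<Longrightarrow> y \<in> C \<Longrightarrow> x ** y = y ** x"
  using C by (simp add: contexts_def)

lemma context_one: "mat 1 \<in> C"
  and context_add: "x \<in> C \<Longrightarrow> y \<in> C \<Longrightarrow> x + y \<in> C"
  and context_mult: "x \<in> C \<Longrightarrow> y \<in> C \<Longrightarrow> x ** y \<in> C"
  and context_scale: "x \<in> C \<Longrightarrow> mat z ** x \<in> C"
  and context_adj: "x \<in> C \<Longrightarrow> adj x \<in> C"
  and context_bicommutant: "commutant (commutant C) = C"
  using C by (auto simp: contexts_def von_neumann_subalgebra_def)

lemma context_minus: "x \<in> C \<Longrightarrow> - x \<in> C"
proof -
  have "mat (-1) ** x = - x"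
    unfolding matrix_eq
  proof
    fix v
    show "(mat (-1) ** x) *v v = (- x) *v v"
      using matrix_vector_mult_diff_rdistrib[of 0 x v] by (simp add: mat_mult_vec flip: matrix_vector_mul_assoc)
  qed
  then show "x \<in> C \<Longrightarrow> - x \<in> C" using context_scale[of x "-1"] by simp
qed

lemma context_diff: "x \<in> C \<Longrightarrow> y \<in> C \<Longrightarrow> x - y \<in> C"
  using context_add[OF _ context_minus, of x y] by simp

lemma context_zero: "0 \<in> C"
  using context_diff[OF context_one context_one] by simp

lemma Proj_compl: "p \<in> Proj C \<Longrightarrow> mat 1 - p \<in> Proj C"
  by (simp add: Proj_def is_projection_compl context_diff context_one)

text \<open>The join of two commuting projections \<open>p\<close>, \<open>q\<close> is \<open>p + q - p ** q\<close>, so a projection of maximal rank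
  below \<open>P\<close> dominates all others.\<close>

lemma largest_projection_exists:
  assumes P: "is_projection P"
  shows "\<exists>d\<in>Proj C. d \<preceq> P \<and> (\<forall>q\<in>Proj C. q \<preceq> P \<longrightarrow> q \<preceq> d)"
proof -
  define Q where "Q q \<longleftrightarrow> q \<in> Proj C \<and> P ** q = q" for q
  define rk :: "'n cmat \<Rightarrow> nat" where "rk q = vec.dim (range ((*v) q))" for q
  have "Q 0" by (simp add: Q_def Proj_def is_projection_zero context_zero)
  moreover have "\<forall>q. Q q \<longrightarrow> rk q < Suc CARD('n)"
    by (metis le_imp_less_Suc rk_def vec.dim_subset_UNIV vec_dim_card vec.dim_subset subset_UNIV)
  ultimately obtain d where d: "Q d" and max: "\<And>q. Q q \<Longrightarrow> rk q \<le> rk d"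
    using ex_has_greatest_nat[of Q 0 rk "Suc CARD('n)"] by (metis less_imp_le)
  have dproj: "is_projection d" and dC: "d \<in> C" using d by (auto simp: Q_def Proj_def)
  have "d ** q = q" if q: "Q q" for q
  proof -
    define j where "j = d + q - d ** q"
    have qproj: "is_projection q" and qC: "q \<in> C" using q by (auto simp: Q_def Proj_def)
    have comm: "q ** d = d ** q" using context_commute qC dC by blast
    note idem = is_projection_idem[OF dproj] is_projection_idem[OF qproj]
    have idem': "d ** (d ** q) = d ** q" "q ** (d ** q) = d ** q"
      by (metis idem(1) matrix_mul_assoc) (metis idem(2) comm matrix_mul_assoc)
    have jd: "j ** d = d" and jq: "j ** q = q"
      by (simp_all add: j_def matrix_mult_diff_left matrix_add_rdistrib idem idem' comm
          flip: matrix_mul_assoc)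
    have "j ** (d + q - d ** q) = j ** d + j ** q - (j ** d) ** q"
      by (simp add: matrix_mult_diff_right matrix_add_ldistrib matrix_mul_assoc)
    then have "j ** j = j" by (simp add: jd jq flip: j_def)
    moreover have "adj j = j"
      by (simp add: j_def adj_add adj_diff adj_mult is_projection_adj dproj qproj comm)
    ultimately have jproj: "is_projection j" by (simp add: is_projection_def self_adjoint_def)
    moreover have "j \<in> C" by (simp add: j_def context_add context_diff context_mult dC qC)
    moreover have "P ** j = j"
      using d q by (simp add: Q_def j_def matrix_mult_diff_right matrix_add_ldistrib matrix_mul_assoc)
    ultimately have "Q j" by (simp add: Q_def Proj_def)
    \<comment> \<open>The join \<open>j\<close> competes with \<open>d\<close> for maximal rank and
      its range contains that of \<open>d\<close>; equal dimension then makes the two projections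
      coincide.\<close>
    have "range ((*v) d) \<subseteq> range ((*v) j)"
      by (metis image_subsetI jd matrix_vector_mul_assoc rangeI)
    moreover have "vec.subspace (range ((*v) x))" for x :: "'n cmat"
      by (intro vec.linear_subspace_image matrix_vector_mul_linear_gen vec.subspace_UNIV)
    ultimately have "range ((*v) d) = range ((*v) j)"
      using max[OF \<open>Q j\<close>] unfolding rk_def by (intro vec.subspace_dim_equal) auto
    then have "d = j" by (rule projection_range_unique[OF dproj jproj])
    then show ?thesis using jq by simp
  qed
  then show ?thesis
    using d by (intro bexI[of _ d]) (auto simp: Q_def Proj_def projection_le_iff P)
qed

text \<open>Since \<open>P\<close> may lie outside \<open>C\<close>, it need not be among the upper
  bounds compared in \<open>Proj_Sup\<close>. The supremum lies below \<open>P\<close> because the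
  projections of \<open>C\<close> below \<open>P\<close> have a largest element.\<close>

lemma inner_das:
  assumes P: "is_projection P"
  shows inner_das_in: "inner_das P C \<in> Proj C"
    and inner_das_le: "inner_das P C \<preceq> P"
    and inner_das_greatest: "q \<in> Proj C \<Longrightarrow> q \<preceq> P \<Longrightarrow> q \<preceq> inner_das P C"
proof -
  obtain d where d: "d \<in> Proj C" "d \<preceq> P" "\<And>q. q \<in> Proj C \<Longrightarrow> q \<preceq> P \<Longrightarrow> q \<preceq> d"
    using largest_projection_exists[OF P] by blast
  have "inner_das P C = d"
    unfolding inner_das_def Proj_Sup_def
  proof (rule the_equality)
    fix s assume "s \<in> Proj C \<and> (\<forall>q\<in>{q \<in> Proj C. q \<preceq> P}. q \<preceq> s) \<and>
        (\<forall>t\<in>Proj C. (\<forall>q\<in>{q \<in> Proj C. q \<preceq> P}. q \<preceq> t) \<longrightarrow> s \<preceq> t)"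
    then have "s \<in> Proj C" "d \<preceq> s" "s \<preceq> d" using d by blast+
    then show "s = d" using d(1) le_elt_antisym by (auto simp: Proj_def)
  qed (use d in blast)
  then show "inner_das P C \<in> Proj C" "inner_das P C \<preceq> P"
    "q \<in> Proj C \<Longrightarrow> q \<preceq> P \<Longrightarrow> q \<preceq> inner_das P C"
    using d by auto
qed

end


section \<open>The Gelfand spectrum of a context\<close>

context
  fixes C :: "'n::finite cmat set"
  assumes C: "C \<in> contexts"
begin

lemma character_one: "\<omega> \<in> gelfand_spectrum C \<Longrightarrow> \<omega> (mat 1) = 1"
  and character_add: "\<omega> \<in> gelfand_spectrum C \<Longrightarrow> x \<in> C \<Longrightarrow> y \<in> C \<Longrightarrow> \<omega> (x + y) = \<omega> x + \<omega> y"
  and character_mult: "\<omega> \<in> gelfand_spectrum C \<Longrightarrow> x \<in> C \<Longrightarrow> y \<in> C \<Longrightarrow> \<omega> (x ** y) = \<omega> x * \<omega> y"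
  and character_scale: "\<omega> \<in> gelfand_spectrum C \<Longrightarrow> x \<in> C \<Longrightarrow> \<omega> (mat z ** x) = z * \<omega> x"
  and character_extensional: "\<omega> \<in> gelfand_spectrum C \<Longrightarrow> \<omega> \<in> extensional C"
  by (simp_all add: gelfand_spectrum_def)

lemma character_diff:
  assumes "\<omega> \<in> gelfand_spectrum C" "x \<in> C" "y \<in> C"
  shows "\<omega> (x - y) = \<omega> x - \<omega> y"
  using character_add[of \<omega> "x - y" y] context_diff[OF C] assms by simp

lemma character_zero: "\<omega> \<in> gelfand_spectrum C \<Longrightarrow> \<omega> 0 = 0"
  using character_diff[of \<omega> "mat 1" "mat 1"] context_one[OF C] by simp

lemma character_sum:
  assumes "\<omega> \<in> gelfand_spectrum C" "\<And>i. i \<in> I \<Longrightarrow> f i \<in> C"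
  shows "(\<Sum>i\<in>I. f i) \<in> C \<and> \<omega> (\<Sum>i\<in>I. f i) = (\<Sum>i\<in>I. \<omega> (f i))"
  using assms(2)
  by (induction I rule: infinite_finite_induct)
    (simp_all add: character_zero character_add context_zero[OF C] context_add[OF C] assms(1))

lemma character_projection: "\<omega> \<in> gelfand_spectrum C \<Longrightarrow> p \<in> Proj C \<Longrightarrow> \<omega> p = 0 \<or> \<omega> p = 1"
  using character_mult[of \<omega> p p] by (auto simp: Proj_def is_projection_idem)

section \<open>Weight spaces and their projections\<close>

definition weight_space :: "('n cmat \<Rightarrow> complex) \<Rightarrow> (complex^'n) set" where
  "weight_space \<omega> = {v. \<forall>x\<in>C. x *v v = \<omega> x *s v}"

text \<open>For a character \<open>\<omega>\<close> this turns out to be the element of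
  \<open>C\<close> whose Gelfand transform is the indicator of the single point
  \<open>\<omega>\<close>.\<close>

definition weight_projection :: "('n cmat \<Rightarrow> complex) \<Rightarrow> 'n cmat" where
  "weight_projection \<omega> = proj_onto (weight_space \<omega>)"

lemma subspace_weight_space: "vec.subspace (weight_space \<omega>)"
  unfolding weight_space_def vec.subspace_def
  by (auto simp: matrix_vector_right_distrib vec.scale_right_distrib vector_scalar_commute
      vec.scale_left_commute)

text \<open>A matrix commuting with \<open>C\<close> preserves the weight space, and so does its
  adjoint, since \<open>C\<close> is closed under adjoints. Hence the projection commutes with the
  commutant of \<open>C\<close>, and the bicommutant property puts it in \<open>C\<close>.\<close>

lemma weight_projection_in: "weight_projection \<omega> \<in> Proj C"
proof -
  have "proj_onto (weight_space \<omega>) ** y = y ** proj_onto (weight_space \<omega>)" if y: "y \<in> commutant C" for y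
  proof (rule proj_onto_commute[OF subspace_weight_space])
    have inv: "z *v w \<in> weight_space \<omega>" if "\<And>x. x \<in> C \<Longrightarrow> z ** x = x ** z" "w \<in> weight_space \<omega>" for z w
      using that unfolding weight_space_def
      by (simp add: matrix_vector_mul_assoc flip: that(1)) (simp add: vector_scalar_commute flip: matrix_vector_mul_assoc)
    fix w assume w: "w \<in> weight_space \<omega>"
    have yx: "y ** x = x ** y" if "x \<in> C" for x using y that by (simp add: commutant_def)
    then show "y *v w \<in> weight_space \<omega>" using inv w by blast
    have "adj y ** x = x ** adj y" if "x \<in> C" for x
      using arg_cong[OF yx[OF context_adj[OF C that]], of adj] by (simp add: adj_mult)
    then show "adj y *v w \<in> weight_space \<omega>" using inv w by blast
  qed
  then have "weight_projection \<omega> \<in> commutant (commutant C)"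
    by (simp add: commutant_def weight_projection_def)
  then show ?thesis
    by (simp add: context_bicommutant[OF C] Proj_def weight_projection_def
        is_projection_proj_onto subspace_weight_space)
qed

lemma weight_projection_C: "weight_projection \<omega> \<in> C"
  using weight_projection_in by (simp add: Proj_def)

lemma mult_weight_projection:
  assumes "x \<in> C"
  shows "x ** weight_projection \<omega> = mat (\<omega> x) ** weight_projection \<omega>"
  using proj_onto_in[OF subspace_weight_space, of \<omega>] assms
  by (simp add: matrix_eq weight_projection_def weight_space_def mat_mult_vec flip: matrix_vector_mul_assoc)

text \<open>Distinct characters are extensional, so they differ at some \<open>x\<close> in
  \<open>C\<close>. On the weight space of \<open>\<omega>'\<close> this \<open>x\<close> acts as
  the scalar \<open>\<omega>' x\<close>; applying \<open>\<omega>\<close> to that relation leaves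
  only the value 0.\<close>

lemma character_weight_projection_neq:
  assumes "\<omega> \<in> gelfand_spectrum C" "\<omega>' \<in> gelfand_spectrum C" "\<omega> \<noteq> \<omega>'"
  shows "\<omega> (weight_projection \<omega>') = 0"
proof -
  obtain x where x: "x \<in> C" "\<omega> x \<noteq> \<omega>' x"
    using assms extensionalityI[OF character_extensional character_extensional] by blast
  have "\<omega> x * \<omega> (weight_projection \<omega>') = \<omega>' x * \<omega> (weight_projection \<omega>')"
    using arg_cong[OF mult_weight_projection[OF x(1), of \<omega>'], of \<omega>]
    by (simp add: character_mult character_scale assms x weight_projection_C)
  then show ?thesis using x(2) by simp
qed

text \<open>The projections commute, and the one for \<open>\<omega>'\<close>, being in
  \<open>C\<close>, acts on the weight space of \<open>\<omega>\<close> as the scalar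
  \<open>\<omega> (weight_projection \<omega>')\<close>, which is 0.\<close>

lemma weight_projection_orthogonal:
  assumes "\<omega> \<in> gelfand_spectrum C" "\<omega>' \<in> gelfand_spectrum C" "\<omega> \<noteq> \<omega>'"
  shows "weight_projection \<omega> ** weight_projection \<omega>' = 0"
proof -
  have "weight_projection \<omega> ** weight_projection \<omega>' = weight_projection \<omega>' ** weight_projection \<omega>"
    by (intro context_commute[OF C] weight_projection_C)
  also have "\<dots> = mat 0 ** weight_projection \<omega>"
    by (simp add: mult_weight_projection weight_projection_C character_weight_projection_neq assms)
  finally show ?thesis by simp
qed

text \<open>A nonzero vector determines its eigenvalues uniquely, so they depend linearly and
  multiplicatively on the element of \<open>C\<close>. Restricting to \<open>C\<close> meets the
  extensionality convention for characters.\<close>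

lemma joint_eigenvector_weight:
  assumes v: "joint_eigenvector C v" "v \<noteq> 0"
  obtains \<omega> where "\<omega> \<in> gelfand_spectrum C" "v \<in> weight_space \<omega>"
proof -
  obtain f where f: "\<And>x. x \<in> C \<Longrightarrow> x *v v = f x *s v"
    using v(1) unfolding joint_eigenvector_def by metis
  have cancel: "c = d" if "c *s v = d *s v" for c d
    using that v(2) by (metis vec.scale_cancel_right)
  have "restrict f C \<in> gelfand_spectrum C"
    unfolding gelfand_spectrum_def
  proof (intro CollectI conjI ballI allI)
    show "restrict f C \<in> extensional C" by simp
    show "restrict f C (mat 1) = 1"
      using f[OF context_one[OF C]] context_one[OF C] by (intro cancel) simp
    fix x assume x: "x \<in> C"
    show "restrict f C (mat z ** x) = z * restrict f C x" for z
      using f[OF context_scale[OF C x, of z]] f[OF x] context_scale[OF C x] x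
      by (intro cancel) (auto simp: mat_mult_vec simp flip: matrix_vector_mul_assoc)
    fix y assume y: "y \<in> C"
    show "restrict f C (x + y) = restrict f C x + restrict f C y"
      using f[OF context_add[OF C x y]] f[OF x] f[OF y] context_add[OF C x y] x y
      by (intro cancel) (simp add: matrix_vector_mult_add_rdistrib vec.scale_left_distrib)
    show "restrict f C (x ** y) = restrict f C x * restrict f C y"
      using f[OF context_mult[OF C x y]] f[OF x] f[OF y] context_mult[OF C x y] x y
      by (intro cancel) (auto simp: vector_scalar_commute mult.commute simp flip: matrix_vector_mul_assoc)
  qed
  moreover have "v \<in> weight_space (restrict f C)" using f by (simp add: weight_space_def)
  ultimately show ?thesis by (rule that)
qed

text \<open>The argument first treats the characters with nonzero weight projection: they are
  finitely many, and their projections sum to 1. Then no other character can exist.\<close>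

lemma finite_gelfand_spectrum: "finite (gelfand_spectrum C)"
  and sum_weight_projections: "(\<Sum>\<omega>\<in>gelfand_spectrum C. weight_projection \<omega>) = mat 1"
proof -
  define I where "I = {\<omega> \<in> gelfand_spectrum C. weight_projection \<omega> \<noteq> 0}"
  have proj: "is_projection (weight_projection \<omega>)" for \<omega>
    using weight_projection_in by (simp add: Proj_def)
  have orth: "weight_projection \<omega> ** weight_projection \<omega>' = 0" if "\<omega> \<in> I" "\<omega>' \<in> I" "\<omega> \<noteq> \<omega>'" for \<omega> \<omega>'
    using weight_projection_orthogonal that by (simp add: I_def)
  have fin: "finite I"
    by (rule finite_orthogonal_projections[OF proj _ orth]) (auto simp: I_def)
  have sum: "(\<Sum>\<omega>\<in>I. weight_projection \<omega>) = mat 1"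
  proof (rule sum_projections_eq_one[OF context_commute[OF C] context_adj[OF C] fin proj orth])
    fix v assume v: "joint_eigenvector C v" "v \<noteq> 0"
    then obtain \<omega> where \<omega>: "\<omega> \<in> gelfand_spectrum C" "v \<in> weight_space \<omega>"
      by (rule joint_eigenvector_weight)
    then have "weight_projection \<omega> *v v = v"
      by (simp add: weight_projection_def proj_onto_fix_iff subspace_weight_space)
    moreover from this have "\<omega> \<in> I" using \<omega> v(2) by (auto simp: I_def)
    ultimately show "\<exists>\<omega>\<in>I. weight_projection \<omega> *v v = v" by blast
  qed
  \<comment> \<open>A character outside \<open>I\<close> differs from every member of
    \<open>I\<close>, so it vanishes on each summand of the identity and would send 1 to 0.\<close>
  have "gelfand_spectrum C \<subseteq> I"
  proof (rule subsetI, rule ccontr)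
    fix \<omega> assume \<omega>: "\<omega> \<in> gelfand_spectrum C" "\<omega> \<notin> I"
    have "1 = (\<Sum>\<omega>'\<in>I. \<omega> (weight_projection \<omega>'))"
      using character_sum[OF \<omega>(1), of I weight_projection] weight_projection_C
      by (simp add: sum character_one \<omega>(1))
    also have "\<dots> = 0"
      by (rule sum.neutral) (use \<omega> in \<open>auto simp: I_def intro!: character_weight_projection_neq\<close>)
    finally show False by simp
  qed
  then have "gelfand_spectrum C = I" by (auto simp: I_def)
  then show "finite (gelfand_spectrum C)" "(\<Sum>\<omega>\<in>gelfand_spectrum C. weight_projection \<omega>) = mat 1"
    using fin sum by auto
qed

lemma character_weight_projection_self:
  assumes \<omega>: "\<omega> \<in> gelfand_spectrum C"
  shows "\<omega> (weight_projection \<omega>) = 1"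
proof -
  have "1 = (\<Sum>\<omega>'\<in>gelfand_spectrum C. \<omega> (weight_projection \<omega>'))"
    using character_sum[OF \<omega>, of "gelfand_spectrum C" weight_projection] weight_projection_C
    by (simp add: sum_weight_projections character_one \<omega>)
  also have "\<dots> = (\<Sum>\<omega>'\<in>gelfand_spectrum C. if \<omega>' = \<omega> then \<omega> (weight_projection \<omega>) else 0)"
    by (rule sum.cong) (auto simp: character_weight_projection_neq \<omega>)
  finally show ?thesis by (simp add: finite_gelfand_spectrum \<omega>)
qed

text \<open>Multiplying the resolution of the identity by \<open>x\<close> inverts the Gelfand
  transform; this computes the integral in the construction of the Riesz measure.\<close>

lemma gelfand_expansion:
  assumes "x \<in> C"
  shows "x = (\<Sum>\<omega>\<in>gelfand_spectrum C. mat (\<omega> x) ** weight_projection \<omega>)"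
proof -
  have "x = x ** (\<Sum>\<omega>\<in>gelfand_spectrum C. weight_projection \<omega>)"
    by (simp add: sum_weight_projections)
  then show ?thesis
    by (simp add: matrix_mult_sum_right mult_weight_projection assms)
qed

text \<open>A finite subspace of a T1 space is discrete. Every subset of a fibre is therefore open,
  compact and measurable.\<close>

lemma gelfand_topology_discrete: "gelfand_topology C = discrete_topology (gelfand_spectrum C)"
  unfolding gelfand_topology_def
proof (rule subtopology_eq_discrete_topology_finite)
  show "t1_space (product_topology (\<lambda>_. euclidean :: complex topology) C)"
    by (simp add: t1_space_product_topology t1_space_euclidean)
  show "gelfand_spectrum C \<subseteq> topspace (product_topology (\<lambda>_. euclidean) C)"
    by (auto simp: PiE_def character_extensional)
qed (rule finite_gelfand_spectrum)

end


section \<open>The Riesz measure of a state\<close>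

context
  fixes \<psi> :: "'n::finite cmat \<Rightarrow> complex"
  assumes \<psi>: "is_state \<psi>"
begin

lemma state_add: "\<psi> (x + y) = \<psi> x + \<psi> y"
  and state_scale: "\<psi> (mat z ** x) = z * \<psi> x"
  and state_one: "\<psi> (mat 1) = 1"
  using \<psi> by (simp_all add: is_state_def)

lemma state_diff: "\<psi> (x - y) = \<psi> x - \<psi> y"
  using state_add[of "x - y" y] by simp

lemma state_sum: "\<psi> (\<Sum>i\<in>I. f i) = (\<Sum>i\<in>I. \<psi> (f i))"
  using state_diff[of 0 0]
  by (induction I rule: infinite_finite_induct) (simp_all add: state_add)

lemma state_positive: "positive_elt x \<Longrightarrow> \<psi> x \<in> \<real>\<^sub>\<ge>\<^sub>0"
  using \<psi> by (simp add: is_state_def)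

lemma state_projection: "is_projection p \<Longrightarrow> \<psi> p = of_real (Re (\<psi> p)) \<and> 0 \<le> Re (\<psi> p)"
  using state_positive[OF positive_projection, of p] by (auto simp: complex_nonneg_Reals_iff complex_eq_iff)

lemma state_mono_zero:
  assumes "is_projection q" "q \<preceq> p" "\<psi> p = 0"
  shows "\<psi> q = 0"
proof -
  have "\<psi> (p - q) \<in> \<real>\<^sub>\<ge>\<^sub>0" "\<psi> q \<in> \<real>\<^sub>\<ge>\<^sub>0"
    using assms positive_projection by (auto simp: le_elt_def intro: state_positive)
  then show ?thesis using assms(3) by (auto simp: state_diff complex_nonneg_Reals_iff complex_eq_iff)
qed

section \<open>Existence and uniqueness of the measure representing a state on a context\<close>

context
  fixes C :: "'n cmat set"
  assumes C: "C \<in> contexts"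
begin

text \<open>This is the property under the description operator of \<open>riesz_measure\<close>,
  named so that existence and uniqueness can be stated separately.\<close>

definition represents_state :: "('n cmat \<Rightarrow> complex) measure \<Rightarrow> bool" where
  "represents_state M \<longleftrightarrow> prob_space M \<and>
     sets M = sigma_sets (gelfand_spectrum C) {U. openin (gelfand_topology C) U} \<and>
     (\<forall>B\<in>sets M. measure M B =
        (SUP K\<in>{K. compactin (gelfand_topology C) K \<and> K \<subseteq> B}. measure M K)) \<and>
     (\<forall>x\<in>C. (\<integral>\<omega>. \<omega> x \<partial>M) = \<psi> x)"

lemma riesz_measure_eq: "riesz_measure \<psi> C = (THE M. represents_state M)"
  by (simp add: riesz_measure_def represents_state_def)

lemma borel_gelfand_spectrum:
  "sigma_sets (gelfand_spectrum C) {U. openin (gelfand_topology C) U} = Pow (gelfand_spectrum C)"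
proof -
  have "{U. openin (gelfand_topology C) U} = Pow (gelfand_spectrum C)"
    by (auto simp: gelfand_topology_discrete[OF C])
  then show ?thesis
    by (simp add: sigma_algebra.sigma_sets_eq sigma_algebra_Pow)
qed

text \<open>The measure puts mass \<open>\<psi> (weight_projection C \<omega>)\<close> at each
  \<open>\<omega>\<close>. The resolution of the identity makes the total mass 1, and the Gelfand
  expansion gives the integral formula.\<close>

lemma represents_state_exists: "\<exists>M. represents_state M"
proof -
  let ?X = "gelfand_spectrum C" and ?e = "weight_projection C"
  define w where "w \<omega> = Re (\<psi> (?e \<omega>))" for \<omega>
  have w: "\<psi> (?e \<omega>) = of_real (w \<omega>)" "0 \<le> w \<omega>" for \<omega>
    using state_projection[of "?e \<omega>"] weight_projection_in[OF C, of \<omega>] by (auto simp: Proj_def w_def)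
  define M where "M = point_measure ?X (\<lambda>\<omega>. ennreal (w \<omega>))"
  have fin: "finite ?X" by (rule finite_gelfand_spectrum[OF C])
  have sets: "sets M = Pow ?X" and space: "space M = ?X"
    by (simp_all add: M_def sets_point_measure space_point_measure)
  have "complex_of_real (\<Sum>\<omega>\<in>?X. w \<omega>) = \<psi> (\<Sum>\<omega>\<in>?X. ?e \<omega>)"
    by (simp add: state_sum w)
  then have "(\<Sum>\<omega>\<in>?X. w \<omega>) = 1"
    by (simp add: sum_weight_projections[OF C] state_one del: of_real_sum)
  then have "emeasure M (space M) = 1"
    unfolding space unfolding M_def by (simp add: emeasure_point_measure_finite fin w(2) sum_ennreal)
  then have prob: "prob_space M" by (rule prob_spaceI)
  interpret prob_space M by (rule prob)
  have "measure M B = (SUP K\<in>{K. compactin (gelfand_topology C) K \<and> K \<subseteq> B}. measure M K)"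
    if "B \<in> sets M" for B
  \<comment> \<open>Inner regularity is trivial: \<open>B\<close> is finite, hence compact, and
    attains the supremum itself.\<close>
  proof (rule cSup_eq_maximum[symmetric])
    have "compactin (gelfand_topology C) B"
      using that fin by (auto simp: gelfand_topology_discrete[OF C] compactin_discrete_topology sets
          intro: finite_subset)
    then show "measure M B \<in> measure M ` {K. compactin (gelfand_topology C) K \<and> K \<subseteq> B}" by blast
  qed (use that in \<open>auto intro: finite_measure_mono\<close>)
  moreover have "(\<integral>\<omega>. \<omega> x \<partial>M) = \<psi> x" if x: "x \<in> C" for x
  proof -
    have "(\<integral>\<omega>. \<omega> x \<partial>M) = (\<Sum>\<omega>\<in>?X. w \<omega> *\<^sub>R \<omega> x)"
      unfolding M_def by (rule lebesgue_integral_point_measure_finite) (auto simp: fin w)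
    also have "\<dots> = \<psi> (\<Sum>\<omega>\<in>?X. mat (\<omega> x) ** ?e \<omega>)"
      by (simp add: state_sum state_scale w scaleR_conv_of_real mult.commute)
    also have "\<dots> = \<psi> x" by (simp flip: gelfand_expansion[OF C x])
    finally show ?thesis .
  qed
  ultimately show ?thesis
    unfolding represents_state_def borel_gelfand_spectrum using prob sets by blast
qed

text \<open>Characters take only the values 0 and 1 on a projection, so its Gelfand transform is an
  indicator and the integral is a measure. The claim covers every representing measure because
  uniqueness rests on it.\<close>

lemma represents_state_projection:
  assumes M: "represents_state M" and p: "p \<in> Proj C"
  shows "complex_of_real (measure M {\<omega> \<in> gelfand_spectrum C. \<omega> p = 1}) = \<psi> p"
proof -
  let ?B = "{\<omega> \<in> gelfand_spectrum C. \<omega> p = 1}"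
  have sets: "sets M = Pow (gelfand_spectrum C)"
    using M by (simp add: represents_state_def borel_gelfand_spectrum)
  \<comment> \<open>Equal sigma-algebras have equal carriers; the counting measure serves as a
    comparison space with the full power set.\<close>
  then have space: "space M = gelfand_spectrum C"
    using sets_eq_imp_space_eq[of M "count_space (gelfand_spectrum C)"] by simp
  have "\<psi> p = (\<integral>\<omega>. \<omega> p \<partial>M)" using M p by (auto simp: represents_state_def Proj_def)
  also have "\<dots> = (\<integral>\<omega>. complex_of_real (indicator ?B \<omega>) \<partial>M)"
    using character_projection[OF C _ p]
    by (intro Bochner_Integration.integral_cong) (auto simp: space indicator_def)
  also have "\<dots> = complex_of_real (measure M ?B)"
    unfolding integral_complex_of_real by (simp add: space Int_absorb2 Collect_mono)
  finally show ?thesis by simp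
qed

text \<open>On a finite set the singletons determine a measure, and each \<open>{\<omega>}\<close>
  is the set where the weight projection of \<open>\<omega>\<close> takes the value 1, so
  \<open>\<psi>\<close> fixes its mass.\<close>

lemma represents_state_unique:
  assumes M: "represents_state M" and N: "represents_state N"
  shows "M = N"
proof (rule measure_eqI_finite)
  show "sets M = Pow (gelfand_spectrum C)" "sets N = Pow (gelfand_spectrum C)"
    using M N by (simp_all add: represents_state_def borel_gelfand_spectrum)
  show "finite (gelfand_spectrum C)" by (rule finite_gelfand_spectrum[OF C])
  fix \<omega> assume \<omega>: "\<omega> \<in> gelfand_spectrum C"
  have eq: "{\<omega>' \<in> gelfand_spectrum C. \<omega>' (weight_projection C \<omega>) = 1} = {\<omega>}"
    using character_weight_projection_self[OF C \<omega>] character_weight_projection_neq[OF C _ \<omega>] \<omega>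
    by force
  have "measure M {\<omega>} = measure N {\<omega>}"
    using represents_state_projection[OF M weight_projection_in[OF C], of \<omega>]
      represents_state_projection[OF N weight_projection_in[OF C], of \<omega>]
    unfolding eq by (metis of_real_eq_iff)
  moreover have "finite_measure M" "finite_measure N"
    using M N by (auto simp: represents_state_def intro: prob_space.finite_measure)
  ultimately show "emeasure M {\<omega>} = emeasure N {\<omega>}"
    by (simp add: finite_measure.emeasure_eq_measure)
qed

lemma riesz_measure_projection:
  assumes "p \<in> Proj C"
  shows "complex_of_real (measure (riesz_measure \<psi> C) {\<omega> \<in> gelfand_spectrum C. \<omega> p = 1}) = \<psi> p"
proof -
  have "represents_state (riesz_measure \<psi> C)"
    unfolding riesz_measure_eq
    using represents_state_exists represents_state_unique by (metis theI')
  then show ?thesis using assms by (rule represents_state_projection)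
qed

end

end

text \<open>The part of the complement of the proposition lying over a maximal context alone is already
  open.\<close>

lemma fibre_heyting_neg_elem_prop:
  assumes max: "maximal_context C" and P: "is_projection (spectral_projection a \<Delta>)"
  shows "fibre (heyting_neg (elem_prop a \<Delta>)) C =
    {\<omega> \<in> gelfand_spectrum C. \<omega> (mat 1 - inner_das (spectral_projection a \<Delta>) C) = 1}"
proof -
  let ?d = "inner_das (spectral_projection a \<Delta>) C"
  have C: "C \<in> contexts" using max by (simp add: maximal_context_def)
  have d: "?d \<in> Proj C" using inner_das_in[OF C P] .
  have eq: "\<omega> (mat 1 - ?d) = 1 \<longleftrightarrow> \<omega> ?d \<noteq> 1" if "\<omega> \<in> gelfand_spectrum C" for \<omega>
    using character_diff[OF C that context_one[OF C], of ?d] character_projection[OF C that d] d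
    by (auto simp: Proj_def character_one[OF C that])
  define V where "V = {C} \<times> {\<omega> \<in> gelfand_spectrum C. \<omega> ?d \<noteq> 1}"
  have fibre_V: "fibre V D = (if D = C then {\<omega> \<in> gelfand_spectrum C. \<omega> ?d \<noteq> 1} else {})" for D
    by (auto simp: fibre_def V_def)
  have "openin Sigma_up_topology V"
    unfolding openin_Sigma_up_topology
  proof (intro conjI ballI impI)
    show "V \<subseteq> Sigma_up" using C by (auto simp: V_def Sigma_up_def)
    show "openin (gelfand_topology D) (fibre V D)" for D
      by (auto simp: fibre_V gelfand_topology_discrete[OF C])
    fix E D \<omega> assume "E \<in> contexts" "D \<in> contexts" "D \<subseteq> E" and \<omega>: "\<omega> \<in> gelfand_spectrum E"
      and r: "restrict \<omega> D \<in> fibre V D"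
    from r have "D = C" by (auto simp: fibre_V split: if_splits)
    \<comment> \<open>Upward closure only concerns contexts above \<open>C\<close>, and maximality
      leaves \<open>C\<close> itself.\<close>
    then have "E = C" using max \<open>E \<in> contexts\<close> \<open>D \<subseteq> E\<close> by (simp add: maximal_context_def)
    then have "restrict \<omega> D = \<omega>"
      using \<open>D = C\<close> \<omega> by (simp add: extensional_restrict gelfand_spectrum_def)
    then show "\<omega> \<in> fibre V E" using r \<open>D = C\<close> \<open>E = C\<close> by simp
  qed
  moreover have "V \<inter> elem_prop a \<Delta> = {}" by (auto simp: V_def elem_prop_def)
  ultimately have "V \<subseteq> heyting_neg (elem_prop a \<Delta>)" by (auto simp: heyting_neg_def)
  \<comment> \<open>For the converse inclusion, every open set in the union defining the negation
    avoids the proposition.\<close>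
  moreover have "heyting_neg (elem_prop a \<Delta>) \<inter> elem_prop a \<Delta> = {}"
    by (auto simp: heyting_neg_def)
  moreover have "heyting_neg (elem_prop a \<Delta>) \<subseteq> Sigma_up"
    by (auto simp: heyting_neg_def openin_Sigma_up_topology)
  ultimately have "fibre (heyting_neg (elem_prop a \<Delta>)) C = {\<omega> \<in> gelfand_spectrum C. \<omega> ?d \<noteq> 1}"
    by (fastforce simp: fibre_def V_def elem_prop_def Sigma_up_def)
  then show ?thesis using eq by auto
qed

theorem proposition4p7:
  fixes \<psi> :: "'n::finite cmat \<Rightarrow> complex"
    and a :: "'n cmat" and \<Delta> :: "real set" and C :: "'n cmat set"
  assumes "is_state \<psi>" and "self_adjoint a" and "open \<Delta>" and "maximal_context C"
  shows "(forces_eq C (int_valuation \<psi> (heyting_neg (elem_prop a \<Delta>))) (\<lambda>_. 1) \<longleftrightarrow>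
          (\<forall>p\<in>Proj C. p \<preceq> spectral_projection a \<Delta> \<longrightarrow> \<psi> p = 0)) \<and>
         ((\<forall>p\<in>Proj C. p \<preceq> spectral_projection a \<Delta> \<longrightarrow> \<psi> p = 0) \<longleftrightarrow>
          (\<forall>p\<in>Proj C. spectral_projection a (UNIV - \<Delta>) \<preceq> p \<longrightarrow> \<psi> p = 1))"
proof
  let ?P = "spectral_projection a \<Delta>"
  let ?d = "inner_das ?P C"
  have C: "C \<in> contexts" using assms(4) by (simp add: maximal_context_def)
  have P: "is_projection ?P" by (rule is_projection_spectral_projection[OF assms(2)])
  have d: "?d \<in> Proj C" "?d \<preceq> ?P" "\<And>q. q \<in> Proj C \<Longrightarrow> q \<preceq> ?P \<Longrightarrow> q \<preceq> ?d"
    using inner_das_in[OF C P] inner_das_le[OF C P] inner_das_greatest[OF C P] by auto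
  have "complex_of_real (int_valuation \<psi> (heyting_neg (elem_prop a \<Delta>)) C) = \<psi> (mat 1 - ?d)"
    unfolding int_valuation_def fibre_heyting_neg_elem_prop[OF assms(4) P]
    by (rule riesz_measure_projection[OF assms(1) C Proj_compl[OF C d(1)]])
  then have "int_valuation \<psi> (heyting_neg (elem_prop a \<Delta>)) C = 1 \<longleftrightarrow> \<psi> (mat 1 - ?d) = 1"
    by (metis of_real_eq_1_iff)
  also have "\<dots> \<longleftrightarrow> \<psi> ?d = 0"
    by (simp add: state_diff[OF assms(1)] state_one[OF assms(1)])
  also have "\<dots> \<longleftrightarrow> (\<forall>p\<in>Proj C. p \<preceq> ?P \<longrightarrow> \<psi> p = 0)"
  proof (intro iffI ballI impI)
    fix p assume "\<psi> ?d = 0" "p \<in> Proj C" "p \<preceq> ?P"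
    then show "\<psi> p = 0" using d(3) state_mono_zero[OF assms(1), of p ?d] by (simp add: Proj_def)
  qed (use d in blast)
  \<comment> \<open>Forcing at \<open>C\<close> quantifies over the contexts above \<open>C\<close>,
    of which maximality leaves only \<open>C\<close>. This equivalence replaces the left end of the
    chain built so far.\<close>
  also have "int_valuation \<psi> (heyting_neg (elem_prop a \<Delta>)) C = 1 \<longleftrightarrow>
      forces_eq C (int_valuation \<psi> (heyting_neg (elem_prop a \<Delta>))) (\<lambda>_. 1)"
    using assms(4) by (auto simp: forces_eq_def maximal_context_def)
  finally show "forces_eq C (int_valuation \<psi> (heyting_neg (elem_prop a \<Delta>))) (\<lambda>_. 1) \<longleftrightarrow>
      (\<forall>p\<in>Proj C. p \<preceq> ?P \<longrightarrow> \<psi> p = 0)" .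
  \<comment> \<open>Both sides assert positivity of the same element
    \<open>?P + p - mat 1\<close>.\<close>
  have swap: "spectral_projection a (UNIV - \<Delta>) \<preceq> p \<longleftrightarrow> mat 1 - p \<preceq> ?P" for p
    by (simp add: le_elt_def spectral_projection_compl[OF assms(2)] algebra_simps)
  \<comment> \<open>Complementation is an involution of \<open>Proj C\<close>, so the quantifier may
    be reindexed by it.\<close>
  have "(\<forall>p\<in>Proj C. p \<preceq> ?P \<longrightarrow> \<psi> p = 0) \<longleftrightarrow> (\<forall>p\<in>Proj C. mat 1 - p \<preceq> ?P \<longrightarrow> \<psi> (mat 1 - p) = 0)"
  proof
    assume *: "\<forall>p\<in>Proj C. mat 1 - p \<preceq> ?P \<longrightarrow> \<psi> (mat 1 - p) = 0"
    show "\<forall>p\<in>Proj C. p \<preceq> ?P \<longrightarrow> \<psi> p = 0"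
    proof
      fix p assume "p \<in> Proj C"
      then show "p \<preceq> ?P \<longrightarrow> \<psi> p = 0"
        using *[rule_format, OF Proj_compl[OF C], of p] by simp
    qed
  qed (simp add: Proj_compl[OF C])
  then show "(\<forall>p\<in>Proj C. p \<preceq> ?P \<longrightarrow> \<psi> p = 0) \<longleftrightarrow>
      (\<forall>p\<in>Proj C. spectral_projection a (UNIV - \<Delta>) \<preceq> p \<longrightarrow> \<psi> p = 1)"
    by (auto simp: swap state_diff[OF assms(1)] state_one[OF assms(1)])
qed

end
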